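(* Let $\mathcal{V}=\{(a,b): a,b\in\mathbb{R}\}$ be the family of bounded open intervals of $\mathbb{R}$. A set $A\subseteq\mathbb{R}$ belongs to $C_\infty(\mathcal{V})$ if and only if $A$ can be written as $P\cup\bigcup_{i=1}^n(a_i,b_i)$ where $a_1<b_1<a_2<\dots<b_n$ (with $a_i,b_i\in\mathbb{R}\cup\{-\infty,+\infty\}$), $a_1$ and $b_n$ are either both finite or both infinite, and $P$ is a finite set disjoint from $\bigcup_{i=1}^n(a_i,b_i)$.
   Context: Take universe $X=\mathbb{R}$. For a family $\mathcal{U}$ of subsets of $X$, let $C_1(\mathcal{U})$ be the family of all sets of the form $E_1\cap E_2$, $E_1\cup E_2$ or $X\setminus E_1$ with $E_1,E_2\in\mathcal{U}$ (possibly $E_1=E_2$). Set $C_0(\mathcal{U})=\mathcal{U}$, $C_n(\mathcal{U})=C_1(C_{n-1}(\mathcal{U}))$ for $n\ge1$, and $C_\infty(\mathcal{U})=\bigcup_{n\ge1}C_n(\mathcal{U})$.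
   Formalization: The chain is a_1<b_1≤a_2<b_2≤…<b_n, so consecutive intervals may share an endpoint; with the printed strict b_i<a_{i+1} the claim fails for (0,1)∪(1,2), which lies in C_1(V). The case n=0 (A finite) is included, with no condition on endpoints. *)

theory Defs
  imports "HOL-Analysis.Interval_Integral"
begin

definition C1 :: "'a set set \<Rightarrow> 'a set set" where
  "C1 \<U> = {E1 \<inter> E2 | E1 E2. E1 \<in> \<U> \<and> E2 \<in> \<U>}
        \<union> {E1 \<union> E2 | E1 E2. E1 \<in> \<U> \<and> E2 \<in> \<U>}
        \<union> {UNIV - E1 | E1. E1 \<in> \<U>}"

primrec Cn :: "nat \<Rightarrow> 'a set set \<Rightarrow> 'a set set" where
  "Cn 0 \<U> = \<U>"
| "Cn (Suc n) \<U> = C1 (Cn n \<U>)"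

definition Cinf :: "'a set set \<Rightarrow> 'a set set" where
  "Cinf \<U> = (\<Union>n\<in>{1..}. Cn n \<U>)"

(* All real a, b are allowed, so the empty set is included (a \<ge> b). *)
definition bounded_open_intervals :: "real set set" where
  "bounded_open_intervals = {{a<..<b} | a b. True}"

(* The endpoint chain is a 1 < b 1 \<le> a 2 < b 2 \<le> ... < b n.  Consecutive intervals may
   share an endpoint: the paper prints b i < a (i+1), but with strict inequality there
   the characterization fails for {0<..<1} \<union> {1<..<2}, a union of two members of the
   generating family.  For n = 0 there are no intervals and no condition on endpoints;
   this case is needed for the finite sets, in particular the empty one. *)
definition endpoint_chain :: "nat \<Rightarrow> (nat \<Rightarrow> ereal) \<Rightarrow> (nat \<Rightarrow> ereal) \<Rightarrow> bool" where
  "endpoint_chain n a b \<longleftrightarrow>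
     (\<forall>i\<in>{1..n}. a i < b i) \<and> (\<forall>i\<in>{1..<n}. b i \<le> a (Suc i))"

end

theory Submission imports Defs begin

text \<open>
  A set lies in \<open>Cinf bounded_open_intervals\<close> iff it is bounded or co-bounded and its indicator is
  constant on every interval avoiding some finite set \<open>F\<close>: both properties are stable under
  the Boolean operations.  Conversely, \<open>F\<close> cuts the line into finitely many gaps, each contained in
  or disjoint from the set, and the gaps contained in it are the intervals of the normal form.
  The condition on the two outer endpoints expresses that the set is bounded or co-bounded.
\<close>

section \<open>Closure properties of \<open>Cinf\<close> and induction over it\<close>

lemma Cn_mono: "m \<le> n \<Longrightarrow> Cn m \<U> \<subseteq> Cn n \<U>"
  by (rule lift_Suc_mono_le) (auto simp: C1_def)

text \<open>Because \<open>E = E \<inter> E\<close>, one application of \<open>C1\<close> loses no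
  set, so the larger of two levels contains both sets. A binary operation on \<open>Cinf\<close>
  thus becomes a single application of \<open>C1\<close>.\<close>

lemma Cinf_common:
  assumes "A \<in> Cinf \<U>" "B \<in> Cinf \<U>"
  obtains n where "A \<in> Cn n \<U>" "B \<in> Cn n \<U>"
proof -
  from assms obtain m n where "A \<in> Cn m \<U>" "B \<in> Cn n \<U>"
    by (auto simp: Cinf_def)
  then show ?thesis
    using that[of "max m n"] Cn_mono[of m "max m n" \<U>] Cn_mono[of n "max m n" \<U>] by auto
qed

lemma Cn_Suc_subset_Cinf: "A \<in> C1 (Cn n \<U>) \<Longrightarrow> A \<in> Cinf \<U>"
  unfolding Cinf_def by (auto intro!: bexI[of _ "Suc n"])

lemma Cinf_Un: "A \<in> Cinf \<U> \<Longrightarrow> B \<in> Cinf \<U> \<Longrightarrow> A \<union> B \<in> Cinf \<U>"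
  by (erule (1) Cinf_common, rule Cn_Suc_subset_Cinf) (auto simp: C1_def)

lemma Cinf_Int: "A \<in> Cinf \<U> \<Longrightarrow> B \<in> Cinf \<U> \<Longrightarrow> A \<inter> B \<in> Cinf \<U>"
  by (erule (1) Cinf_common, rule Cn_Suc_subset_Cinf) (auto simp: C1_def)

lemma Cinf_Compl: "A \<in> Cinf \<U> \<Longrightarrow> - A \<in> Cinf \<U>"
  by (rule Cinf_common[of A \<U> A], assumption+, rule Cn_Suc_subset_Cinf)
    (auto simp: C1_def Compl_eq_Diff_UNIV)

text \<open>The union defining \<open>Cinf\<close> starts at level 1; a generator is already there
  as its own intersection with itself.\<close>

lemma Cinf_base: "A \<in> \<U> \<Longrightarrow> A \<in> Cinf \<U>"
  by (rule Cn_Suc_subset_Cinf[of _ 0]) (auto simp: C1_def)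

lemma Cinf_UN:
  assumes "finite I" "{} \<in> Cinf \<U>" "\<And>i. i \<in> I \<Longrightarrow> f i \<in> Cinf \<U>"
  shows "(\<Union>i\<in>I. f i) \<in> Cinf \<U>"
  using assms by (induction I rule: finite_induct) (auto intro: Cinf_Un)

text \<open>Minimality of \<open>Cinf\<close> among the families that contain the generators and are
  closed under the Boolean operations, in the form used to establish invariants.\<close>

lemma Cinf_induct [consumes 1, case_names base Int Un Compl]:
  assumes "A \<in> Cinf \<U>"
    and base: "\<And>A. A \<in> \<U> \<Longrightarrow> Q A"
    and Int: "\<And>A B. Q A \<Longrightarrow> Q B \<Longrightarrow> Q (A \<inter> B)"
    and Un: "\<And>A B. Q A \<Longrightarrow> Q B \<Longrightarrow> Q (A \<union> B)"
    and Compl: "\<And>A. Q A \<Longrightarrow> Q (- A)"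
  shows "Q A"
proof -
  have "A \<in> Cn n \<U> \<Longrightarrow> Q A" for n A
    by (induction n arbitrary: A)
      (auto simp: C1_def Compl_eq_Diff_UNIV[symmetric] intro: base Int Un Compl)
  then show ?thesis
    using assms(1) by (auto simp: Cinf_def)
qed

section \<open>Basic members of the algebra\<close>

abbreviation (input) interval_algebra :: "real set set" where
  "interval_algebra \<equiv> Cinf bounded_open_intervals"

lemma open_interval_in_algebra: "{a<..<b} \<in> interval_algebra"
  by (rule Cinf_base) (auto simp: bounded_open_intervals_def)

lemma empty_in_algebra: "{} \<in> interval_algebra"
  using open_interval_in_algebra[of 0 0] by simp

lemma singleton_in_algebra: "{x} \<in> interval_algebra"
proof -
  \<comment> \<open>Removing the two open halves from an interval around \<open>x\<close> leaves
    only its centre.\<close>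
  have "{x} = {x-1<..<x+1} \<inter> - ({x-1<..<x} \<union> {x<..<x+1})"
    by auto
  then show ?thesis
    by (metis Cinf_Int Cinf_Un Cinf_Compl open_interval_in_algebra)
qed

lemma finite_in_algebra: "finite P \<Longrightarrow> P \<in> interval_algebra"
  using Cinf_UN[of P bounded_open_intervals "\<lambda>x. {x}"] empty_in_algebra singleton_in_algebra
  by simp

text \<open>The hypotheses let an infinite end occur only in an empty interval. What remains is the
  case of two real ends, which gives a generator.\<close>

lemma bounded_einterval_in_algebra:
  assumes "a = -\<infinity> \<Longrightarrow> b = -\<infinity>" "b = \<infinity> \<Longrightarrow> a = \<infinity>"
  shows "einterval a b \<in> interval_algebra"
  using assms empty_in_algebra open_interval_in_algebra
  by (cases a; cases b) (auto simp: einterval_def greaterThanLessThan_def greaterThan_def lessThan_def Int_def)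

section \<open>Two invariants: piecewise constancy and agreement of the two ends\<close>

definition const_off :: "real set \<Rightarrow> real set \<Rightarrow> bool" where
  "const_off F A \<longleftrightarrow> (\<forall>x y. x < y \<longrightarrow> {x..y} \<inter> F = {} \<longrightarrow> (x \<in> A \<longleftrightarrow> y \<in> A))"

definition piecewise_const :: "real set \<Rightarrow> bool" where
  "piecewise_const A \<longleftrightarrow> (\<exists>F. finite F \<and> const_off F A)"

text \<open>Enlarging \<open>F\<close> weakens \<open>const_off F A\<close>, so the union of the two
  exceptional sets serves both sets at once.\<close>

lemma piecewise_const_Un: "piecewise_const A \<Longrightarrow> piecewise_const B \<Longrightarrow> piecewise_const (A \<union> B)"
  unfolding piecewise_const_def const_off_def
  by (elim exE, rule_tac x = "F \<union> Fa" in exI) (simp add: Int_Un_distrib)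

lemma piecewise_const_Compl: "piecewise_const A \<Longrightarrow> piecewise_const (- A)"
  unfolding piecewise_const_def const_off_def by simp

lemma piecewise_const_Int: "piecewise_const A \<Longrightarrow> piecewise_const B \<Longrightarrow> piecewise_const (A \<inter> B)"
  using piecewise_const_Compl[OF piecewise_const_Un[of "- A" "- B"]] piecewise_const_Compl
  by simp

lemma piecewise_const_finite: "finite P \<Longrightarrow> piecewise_const P"
  unfolding piecewise_const_def const_off_def by (rule exI[of _ P]) (fastforce simp: disjoint_iff)

lemma piecewise_const_einterval: "piecewise_const (einterval a b)"
proof -
  \<comment> \<open>The exceptional points are the real endpoints; the preimage under
    \<open>ereal\<close> drops the infinite ones.\<close>
  have "finite (ereal -` {a, b})"
    by (rule finite_vimageI) auto
  moreover have "const_off (ereal -` {a, b}) (einterval a b)"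
    unfolding const_off_def
  proof (intro allI impI)
    fix x y :: real
    assume "x < y" and disj: "{x..y} \<inter> ereal -` {a, b} = {}"
    \<comment> \<open>An endpoint outside \<open>{x..y}\<close> lies strictly to one side of it, so
      \<open>x\<close> and \<open>y\<close> compare with it in the same way.\<close>
    have "c < ereal x \<or> ereal y < c" if "c \<in> {a, b}" for c
    proof (cases c)
      case (real r)
      with disj that have "r \<notin> {x..y}"
        by blast
      with real show ?thesis by auto
    qed auto
    then have "a < ereal x \<or> ereal y < a" "b < ereal x \<or> ereal y < b"
      by blast+
    moreover have "ereal x < ereal y"
      using \<open>x < y\<close> by simp
    ultimately have "a < ereal x \<longleftrightarrow> a < ereal y" "ereal x < b \<longleftrightarrow> ereal y < b"
      by (metis less_trans less_asym)+
    then show "x \<in> einterval a b \<longleftrightarrow> y \<in> einterval a b"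
      by (simp add: einterval_def)
  qed
  ultimately show ?thesis
    unfolding piecewise_const_def by blast
qed

lemma piecewise_const_UN:
  "finite I \<Longrightarrow> (\<And>i. i \<in> I \<Longrightarrow> piecewise_const (f i)) \<Longrightarrow> piecewise_const (\<Union>i\<in>I. f i)"
  by (induction I rule: finite_induct) (auto intro: piecewise_const_Un piecewise_const_finite)

text \<open>For a piecewise constant set this says that it contains both far ends of the line or
  neither. A half-line fails it, which is what keeps half-lines out of the algebra.\<close>

definition ends_agree :: "real set \<Rightarrow> bool" where
  "ends_agree A \<longleftrightarrow> (\<exists>M. A \<subseteq> {-M..M} \<or> - A \<subseteq> {-M..M})"

lemma ends_agree_Compl: "ends_agree A \<Longrightarrow> ends_agree (- A)"
  by (auto simp: ends_agree_def)

lemma ends_agree_Un: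
  assumes "ends_agree A" "ends_agree B"
  shows "ends_agree (A \<union> B)"
proof -
  from assms obtain M N where
    "A \<subseteq> {-M..M} \<or> - A \<subseteq> {-M..M}" "B \<subseteq> {-N..N} \<or> - B \<subseteq> {-N..N}"
    by (auto simp: ends_agree_def)
  moreover have "{-M..M} \<subseteq> {- max M N..max M N}" "{-N..N} \<subseteq> {- max M N..max M N}"
    by auto
  \<comment> \<open>Two bounded sets have a bounded union; if one of the sets is co-bounded, the
    complement of the union lies in its bounded complement.\<close>
  ultimately have "A \<union> B \<subseteq> {- max M N..max M N} \<or> - (A \<union> B) \<subseteq> {- max M N..max M N}"
    by blast
  then show ?thesis
    unfolding ends_agree_def by blast
qed

lemma ends_agree_Int: "ends_agree A \<Longrightarrow> ends_agree B \<Longrightarrow> ends_agree (A \<inter> B)"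
  using ends_agree_Compl[OF ends_agree_Un[of "- A" "- B"]] ends_agree_Compl by simp

lemma ends_agree_open_interval: "ends_agree {a<..<b}"
  unfolding ends_agree_def by (rule exI[of _ "max \<bar>a\<bar> \<bar>b\<bar>"]) auto

lemma algebra_imp_piecewise_const:
  "A \<in> interval_algebra \<Longrightarrow> piecewise_const A \<and> ends_agree A"
proof (induction rule: Cinf_induct)
  case (base A)
  then obtain a b where "A = {a<..<b}"
    by (auto simp: bounded_open_intervals_def)
  then show ?case
    using piecewise_const_einterval[of "ereal a" "ereal b"] ends_agree_open_interval
    by simp
qed (auto intro: piecewise_const_Int piecewise_const_Un piecewise_const_Compl
      ends_agree_Int ends_agree_Un ends_agree_Compl)

section \<open>The gaps cut out by a finite set\<close>

definition gap_end :: "real set \<Rightarrow> ereal \<Rightarrow> ereal" where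
  "gap_end F p = Min (insert \<infinity> {q \<in> ereal ` F. p < q})"

text \<open>A gap is encoded by its left end: \<open>-\<infinity>\<close> for the leftmost gap,
  otherwise a point of \<open>F\<close>. Its right end is then the next point of \<open>F\<close>,
  with \<open>\<infinity>\<close> as the default after the last one.\<close>

definition gap_starts :: "real set \<Rightarrow> real set \<Rightarrow> ereal set" where
  "gap_starts F A = {p \<in> insert (-\<infinity>) (ereal ` F). einterval p (gap_end F p) \<subseteq> A}"

context
  fixes F :: "real set"
  assumes fin: "finite F"
begin

lemma gap_end_in: "gap_end F p \<in> insert \<infinity> (ereal ` F)"
proof -
  have "gap_end F p \<in> insert \<infinity> {q \<in> ereal ` F. p < q}"
    unfolding gap_end_def by (rule Min_in) (use fin in auto)
  then show ?thesis by auto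
qed

lemma gap_end_greater: "p \<noteq> \<infinity> \<Longrightarrow> p < gap_end F p"
  unfolding gap_end_def by (subst Min_gr_iff) (use fin in auto)

lemma gap_end_le: "q \<in> ereal ` F \<Longrightarrow> p < q \<Longrightarrow> gap_end F p \<le> q"
  unfolding gap_end_def by (rule Min_le) (use fin in auto)

lemma gap_disjoint: "einterval p (gap_end F p) \<inter> F = {}"
  using gap_end_le[of _ p] by (force simp: einterval_def)

lemma finite_gap_starts: "finite (gap_starts F A)"
  unfolding gap_starts_def using fin by auto

lemma gap_start_less: "p \<in> gap_starts F A \<Longrightarrow> p < gap_end F p"
  by (rule gap_end_greater) (auto simp: gap_starts_def)

lemma in_gap:
  assumes "x \<notin> F"
  obtains p where "p \<in> insert (-\<infinity>) (ereal ` F)" "x \<in> einterval p (gap_end F p)"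
proof -
  let ?S = "insert (-\<infinity>) {q \<in> ereal ` F. q < ereal x}"
  \<comment> \<open>The nearest point of \<open>F\<close> to the left of \<open>x\<close>, or
    \<open>-\<infinity>\<close> if there is none.\<close>
  define p where "p = Max ?S"
  have S: "finite ?S" "?S \<noteq> {}"
    using fin by auto
  have "p \<in> ?S"
    unfolding p_def using S by (rule Max_in)
  then have p: "p \<in> insert (-\<infinity>) (ereal ` F)" "p < ereal x"
    by auto
  \<comment> \<open>Otherwise the gap would end at a point of \<open>F\<close> that is below
    \<open>x\<close> but beyond \<open>p\<close>, against the maximality of
    \<open>p\<close>.\<close>
  have "ereal x < gap_end F p"
  proof (rule ccontr)
    assume *: "\<not> ereal x < gap_end F p"
    then have "gap_end F p \<in> ereal ` F"
      using gap_end_in[of p] by auto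
    moreover from this have "gap_end F p \<noteq> ereal x"
      using assms by auto
    ultimately have "gap_end F p \<in> ?S"
      using * by auto
    then have "gap_end F p \<le> p"
      unfolding p_def using S(1) by (rule Max_ge[rotated])
    moreover have "p < gap_end F p"
      using p(2) by (intro gap_end_greater) auto
    ultimately show False by simp
  qed
  with p that show thesis
    by (auto simp: einterval_def)
qed

lemma gap_decomposition:
  assumes "const_off F A"
  shows "A = (A \<inter> F) \<union> (\<Union>p\<in>gap_starts F A. einterval p (gap_end F p))"
proof (intro equalityI subsetI)
  fix x assume x: "x \<in> A"
  show "x \<in> (A \<inter> F) \<union> (\<Union>p\<in>gap_starts F A. einterval p (gap_end F p))"
  proof (cases "x \<in> F")
    case False
    then obtain p where p: "p \<in> insert (-\<infinity>) (ereal ` F)" and xp: "x \<in> einterval p (gap_end F p)"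
      by (rule in_gap)
    \<comment> \<open>A gap that meets \<open>A\<close> is contained in it: the segment between
      \<open>x\<close> and \<open>y\<close>, in whichever order they come, stays inside the gap and
      so avoids \<open>F\<close>.\<close>
    have "y \<in> A" if y: "y \<in> einterval p (gap_end F p)" for y
    proof -
      have "{min x y..max x y} \<subseteq> einterval p (gap_end F p)"
      proof
        fix z assume z: "z \<in> {min x y..max x y}"
        then have "ereal (min x y) \<le> ereal z" "ereal z \<le> ereal (max x y)"
          by (simp_all del: ereal_min ereal_max)
        moreover have "p < ereal (min x y)" "ereal (max x y) < gap_end F p"
          using xp y by (auto simp: einterval_def min_def max_def)
        ultimately have "p < ereal z" "ereal z < gap_end F p"
          by (metis less_le_trans, metis le_less_trans)
        then show "z \<in> einterval p (gap_end F p)"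
          by (simp add: einterval_def)
      qed
      then have "{min x y..max x y} \<inter> F = {}"
        using gap_disjoint by blast
      then show ?thesis
        using assms x unfolding const_off_def
        by (cases x y rule: linorder_cases) (force simp: min_def max_def)+
    qed
    then show ?thesis
      using p xp by (auto simp: gap_starts_def)
  qed (use x in auto)
qed (auto simp: gap_starts_def)

end

text \<open>A gap contained in a bounded set has two real ends and is a generator; beyond these
  finitely many gaps, \<open>A\<close> has only finitely many points.\<close>

lemma bounded_piecewise_const_in_algebra:
  assumes "piecewise_const A" and bdd: "A \<subseteq> {-M..M}"
  shows "A \<in> interval_algebra"
proof -
  obtain F where F: "finite F" "const_off F A"
    using assms(1) by (auto simp: piecewise_const_def)
  have "einterval p (gap_end F p) \<in> interval_algebra" if p: "p \<in> gap_starts F A" for p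
  proof (rule bounded_einterval_in_algebra)
    have less: "p < gap_end F p"
      using gap_start_less[OF F(1) p] .
    have sub: "einterval p (gap_end F p) \<subseteq> {-M..M}"
      using p bdd by (auto simp: gap_starts_def)
    show "gap_end F p = -\<infinity>" if "p = -\<infinity>"
    proof -
      \<comment> \<open>A real below both the end of the gap and \<open>-M\<close> would lie in the
        gap but not in \<open>{-M..M}\<close>. So \<open>p = -\<infinity>\<close> is contradictory
        and the implication holds vacuously.\<close>
      have "-\<infinity> < min (gap_end F p) (ereal (-M))"
        using less that by auto
      then obtain z where "-\<infinity> < ereal z" "ereal z < min (gap_end F p) (ereal (-M))"
        by (rule ereal_dense2[THEN exE]) auto
      then have "z \<in> einterval p (gap_end F p)" "z \<notin> {-M..M}"
        using that by (auto simp: einterval_def)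
      with sub show ?thesis by blast
    qed
    show "p = \<infinity>" if "gap_end F p = \<infinity>"
    proof -
      have "max p (ereal M) < \<infinity>"
        using less that by (simp add: max_def)
      then obtain z where "max p (ereal M) < ereal z" "ereal z < \<infinity>"
        by (rule ereal_dense2[THEN exE]) auto
      then have "z \<in> einterval p (gap_end F p)" "z \<notin> {-M..M}"
        using that by (auto simp: einterval_def)
      with sub show ?thesis by blast
    qed
  qed
  then have "(\<Union>p\<in>gap_starts F A. einterval p (gap_end F p)) \<in> interval_algebra"
    by (intro Cinf_UN finite_gap_starts F(1) empty_in_algebra)
  moreover have "A \<inter> F \<in> interval_algebra"
    using F(1) by (intro finite_in_algebra) auto
  ultimately show ?thesis
    using gap_decomposition[OF F] Cinf_Un by metis
qed

section \<open>Listing the gaps in order: the normal form\<close>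

lemma finite_set_strict_mono_enumeration:
  fixes L :: "'a::linorder set"
  assumes "finite L"
  obtains a :: "nat \<Rightarrow> 'a" where "a ` {1..card L} = L"
    "\<And>i j. 1 \<le> i \<Longrightarrow> i < j \<Longrightarrow> j \<le> card L \<Longrightarrow> a i < a j"
proof
  let ?xs = "sorted_list_of_set L"
  \<comment> \<open>List positions start at 0, the intervals of the normal form at 1.\<close>
  let ?a = "\<lambda>i. ?xs ! (i - 1)"
  have len: "length ?xs = card L"
    by simp
  have "(\<lambda>i. i - 1) ` {1..card L} = {..<card L}"
    by (force simp: image_iff Bex_def intro: exI[of _ "Suc _"])
  then have "?a ` {1..card L} = (!) ?xs ` {..<length ?xs}"
    unfolding len by (metis image_image)
  also have "\<dots> = set ?xs"
    by (auto simp: set_conv_nth)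
  finally show "?a ` {1..card L} = L"
    using assms by simp
  show "?a i < ?a j" if "1 \<le> i" "i < j" "j \<le> card L" for i j
    by (rule sorted_wrt_nth_less[of "(<)"]) (use that in auto)
qed

lemma piecewise_const_imp_normal_form:
  assumes "piecewise_const A" "ends_agree A"
  obtains n a b P where
    "endpoint_chain n a b"
    "n \<ge> 1 \<longrightarrow> (\<bar>a 1\<bar> \<noteq> \<infinity> \<and> \<bar>b n\<bar> \<noteq> \<infinity>) \<or> (\<bar>a 1\<bar> = \<infinity> \<and> \<bar>b n\<bar> = \<infinity>)"
    "finite P"
    "P \<inter> (\<Union>i\<in>{1..n}. einterval (a i) (b i)) = {}"
    "A = P \<union> (\<Union>i\<in>{1..n}. einterval (a i) (b i))"
proof -
  obtain F where F: "finite F" "const_off F A"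
    using assms(1) by (auto simp: piecewise_const_def)
  obtain M where M: "A \<subseteq> {-M..M} \<or> - A \<subseteq> {-M..M}"
    using assms(2) by (auto simp: ends_agree_def)
  define n where "n = card (gap_starts F A)"
  obtain a where a: "a ` {1..n} = gap_starts F A"
    and a_less: "\<And>i j. 1 \<le> i \<Longrightarrow> i < j \<Longrightarrow> j \<le> n \<Longrightarrow> a i < a j"
    using finite_set_strict_mono_enumeration[OF finite_gap_starts[OF F(1)]] unfolding n_def by metis
  define b where "b = (\<lambda>i. gap_end F (a i))"
  have a_in: "a i \<in> insert (-\<infinity>) (ereal ` F)" if "i \<in> {1..n}" for i
    using that a unfolding gap_starts_def by blast
  have b_in: "b i \<in> insert \<infinity> (ereal ` F)" for i
    unfolding b_def by (rule gap_end_in[OF F(1)])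
  have ab: "a i < b i" if "i \<in> {1..n}" for i
    unfolding b_def by (rule gap_start_less[OF F(1), where A = A]) (use that a in auto)
  \<comment> \<open>As \<open>a i\<close> precedes it, \<open>a j\<close> is not
    \<open>-\<infinity>\<close>, hence is a point of \<open>F\<close> beyond \<open>a i\<close>; the
    gap starting at \<open>a i\<close> ends there at the latest. Equality occurs when the two gaps
    share an endpoint.\<close>
  have ba: "b i \<le> a j" if "1 \<le> i" "i < j" "j \<le> n" for i j
  proof -
    have "a j \<in> ereal ` F"
      using a_in[of j] a_less[OF that] that by auto
    then show ?thesis
      unfolding b_def using gap_end_le[OF F(1)] a_less[OF that] by blast
  qed
  have U: "(\<Union>i\<in>{1..n}. einterval (a i) (b i)) = (\<Union>p\<in>gap_starts F A. einterval p (gap_end F p))"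
    unfolding b_def a[symmetric] by simp
  have A: "A = (A \<inter> F) \<union> (\<Union>i\<in>{1..n}. einterval (a i) (b i))"
    unfolding U by (rule gap_decomposition[OF F])
  have disj: "(A \<inter> F) \<inter> (\<Union>i\<in>{1..n}. einterval (a i) (b i)) = {}"
    unfolding b_def using gap_disjoint[OF F(1)] by blast
  obtain K where K: "F \<subseteq> {-K..K}"
  proof -
    obtain K where "\<forall>x\<in>F. \<bar>x\<bar> \<le> K"
      using finite_imp_bounded[OF F(1)] by (auto simp: bounded_iff)
    then have "F \<subseteq> {-K..K}"
      by (auto simp: abs_le_iff minus_le_iff)
    then show thesis by (rule that)
  qed
  \<comment> \<open>The points \<open>R\<close> and \<open>-R\<close> test the two far ends: the
    added 1 puts them strictly beyond \<open>F\<close> and outside \<open>{-M..M}\<close>.\<close>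
  define R where "R = max \<bar>M\<bar> \<bar>K\<bar> + 1"
  have R: "R \<notin> F" "-R \<notin> F" "R \<notin> {-M..M}" "-R \<notin> {-M..M}"
    using K by (force simp: R_def)+
  have below: "q < ereal R" "ereal (-R) < q" if "q \<in> ereal ` F" for q
    using that K by (force simp: R_def)+
  have left: "-R \<in> A \<longleftrightarrow> a 1 = -\<infinity>" if "n \<ge> 1"
  proof
    assume "-R \<in> A"
    then obtain i where i: "i \<in> {1..n}" "-R \<in> einterval (a i) (b i)"
      using A R(2) by blast
    \<comment> \<open>\<open>-R\<close> is to the left of all of \<open>F\<close>, so an interval
      containing it starts at \<open>-\<infinity>\<close>; as the left ends increase strictly, it is
      the first one.\<close>
    then have inf: "a i = -\<infinity>"
      using a_in[OF i(1)] below(2)[of "a i"] by (auto simp: einterval_def)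
    have "i = 1"
      using a_less[of 1 i] inf i(1) by (cases "i = 1") auto
    with inf show "a 1 = -\<infinity>" by simp
  next
    assume inf: "a 1 = -\<infinity>"
    then have "ereal (-R) < b 1"
      using b_in[of 1] below(2)[of "b 1"] by auto
    then have "-R \<in> einterval (a 1) (b 1)"
      using inf by (auto simp: einterval_def)
    then show "-R \<in> A"
      using A that by fastforce
  qed
  have right: "R \<in> A \<longleftrightarrow> b n = \<infinity>" if "n \<ge> 1"
  proof
    assume "R \<in> A"
    then obtain i where i: "i \<in> {1..n}" "R \<in> einterval (a i) (b i)"
      using A R(1) by blast
    then have inf: "b i = \<infinity>"
      using b_in[of i] below(1)[of "b i"] by (auto simp: einterval_def)
    \<comment> \<open>For \<open>i < n\<close> the chain would give
      \<open>\<infinity> = b i \<le> a n < b n\<close>.\<close>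
    have "i = n"
      using ba[of i n] ab[of n] inf i(1) that by (cases "i = n") auto
    with inf show "b n = \<infinity>" by simp
  next
    assume inf: "b n = \<infinity>"
    then have "a n < ereal R"
      using a_in[of n] below(1)[of "a n"] that by auto
    then have "R \<in> einterval (a n) (b n)"
      using inf by (auto simp: einterval_def)
    then show "R \<in> A"
      using A that by fastforce
  qed
  \<comment> \<open>Both test points are outside \<open>A\<close> if \<open>A\<close> is bounded,
    and both are inside if it is co-bounded.\<close>
  have "R \<in> A \<longleftrightarrow> -R \<in> A"
    using M R by blast
  moreover have "a 1 \<noteq> \<infinity>" "b n \<noteq> -\<infinity>" if "n \<ge> 1"
    using ab[of 1] ab[of n] that by auto
  ultimately have ends: "n \<ge> 1 \<longrightarrow>
      (\<bar>a 1\<bar> \<noteq> \<infinity> \<and> \<bar>b n\<bar> \<noteq> \<infinity>) \<or> (\<bar>a 1\<bar> = \<infinity> \<and> \<bar>b n\<bar> = \<infinity>)"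
    using left right by (auto simp: ereal_infinity_cases)
  have "endpoint_chain n a b"
    using ab ba by (auto simp: endpoint_chain_def)
  then show thesis
    using ends _ disj A by (rule that) (use F(1) in auto)
qed

section \<open>From the normal form back to the algebra\<close>

lemma normal_form_in_algebra:
  assumes chain: "endpoint_chain n a b"
    and ends: "n \<ge> 1 \<longrightarrow> (\<bar>a 1\<bar> \<noteq> \<infinity> \<and> \<bar>b n\<bar> \<noteq> \<infinity>) \<or> (\<bar>a 1\<bar> = \<infinity> \<and> \<bar>b n\<bar> = \<infinity>)"
    and P: "finite P"
    and A: "A = P \<union> (\<Union>i\<in>{1..n}. einterval (a i) (b i))"
  shows "A \<in> interval_algebra"
\<comment> \<open>With infinite outer ends the complement is bounded and piecewise constant, which
  reduces to the bounded case. Otherwise, including \<open>n = 0\<close>, every interval has real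
  ends and is itself a generator.\<close>
proof (cases "n \<ge> 1 \<and> \<bar>a 1\<bar> = \<infinity>")
  case True
  have ab: "a 1 < b 1" "a n < b n"
    using chain True by (auto simp: endpoint_chain_def)
  then have inf: "a 1 = -\<infinity>" "b n = \<infinity>"
    using True ends by auto
  \<comment> \<open>The first interval contains every real up to \<open>r\<close>, the last every
    real from \<open>s\<close> on, so the complement lies between \<open>r\<close> and
    \<open>s\<close>.\<close>
  obtain r s where r: "ereal r < b 1" and s: "a n < ereal s"
    using ab ereal_dense2 by blast
  have "piecewise_const (- A)"
    unfolding A
    by (intro piecewise_const_Compl piecewise_const_Un piecewise_const_UN
        piecewise_const_einterval piecewise_const_finite P finite_atLeastAtMost)
  moreover have "- A \<subseteq> {- max \<bar>r\<bar> \<bar>s\<bar>..max \<bar>r\<bar> \<bar>s\<bar>}"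
  proof
    fix x assume "x \<in> - A"
    then have "x \<notin> einterval (a 1) (b 1)" "x \<notin> einterval (a n) (b n)"
      using A True by auto
    then have "b 1 \<le> ereal x" "ereal x \<le> a n"
      using inf by (auto simp: einterval_def)
    then have "ereal r < ereal x" "ereal x < ereal s"
      using r s by (metis less_le_trans, metis le_less_trans)
    then show "x \<in> {- max \<bar>r\<bar> \<bar>s\<bar>..max \<bar>r\<bar> \<bar>s\<bar>}"
      by auto
  qed
  ultimately have "- A \<in> interval_algebra"
    by (rule bounded_piecewise_const_in_algebra)
  then show ?thesis
    using Cinf_Compl by fastforce
next
  case False
  have "einterval (a i) (b i) \<in> interval_algebra" if i: "i \<in> {1..n}" for i
  proof (rule bounded_einterval_in_algebra)
    have ab: "a j < b j" if "j \<in> {1..n}" for j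
      using chain that by (auto simp: endpoint_chain_def)
    have ba: "b j \<le> a (Suc j)" if "j \<in> {1..<n}" for j
      using chain that by (auto simp: endpoint_chain_def)
    \<comment> \<open>Only the outer ends could be infinite: for \<open>i > 1\<close> the preceding
      interval gives \<open>a (i - 1) < b (i - 1) \<le> a i\<close>, and the following one bounds
      \<open>b i\<close> in the same way.\<close>
    have "a i \<noteq> -\<infinity>"
    proof (cases "i = 1")
      case True
      then show ?thesis using False i by auto
    next
      case False
      then obtain k where "i = Suc k" "k \<in> {1..<n}"
        using i by (cases i) auto
      then show ?thesis using ab[of k] ba[of k] by auto
    qed
    moreover have "b i \<noteq> \<infinity>"
    proof (cases "i = n")
      case True
      then show ?thesis using False ends i by auto
    next
      case False
      then show ?thesis using ab[of "Suc i"] ba[of i] i by auto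
    qed
    ultimately show "a i = -\<infinity> \<Longrightarrow> b i = -\<infinity>" "b i = \<infinity> \<Longrightarrow> a i = \<infinity>"
      by auto
  qed
  then show ?thesis
    unfolding A
    by (intro Cinf_Un[OF finite_in_algebra[OF P]] Cinf_UN finite_atLeastAtMost empty_in_algebra)
qed

theorem theorem4p10:
  fixes A :: "real set"
  shows "A \<in> Cinf bounded_open_intervals \<longleftrightarrow>
    (\<exists>(n::nat) (a :: nat \<Rightarrow> ereal) (b :: nat \<Rightarrow> ereal) (P :: real set).
       endpoint_chain n a b \<and>
       (n \<ge> 1 \<longrightarrow> (\<bar>a 1\<bar> \<noteq> \<infinity> \<and> \<bar>b n\<bar> \<noteq> \<infinity>) \<or> (\<bar>a 1\<bar> = \<infinity> \<and> \<bar>b n\<bar> = \<infinity>)) \<and>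
       finite P \<and>
       P \<inter> (\<Union>i\<in>{1..n}. einterval (a i) (b i)) = {} \<and>
       A = P \<union> (\<Union>i\<in>{1..n}. einterval (a i) (b i)))" (is "_ \<longleftrightarrow> ?R")
proof
  assume "A \<in> interval_algebra"
  then have "piecewise_const A" "ends_agree A"
    using algebra_imp_piecewise_const by auto
  then show ?R
    by (rule piecewise_const_imp_normal_form) (intro exI conjI)
next
  assume ?R
  then show "A \<in> interval_algebra"
    by (elim exE conjE) (rule normal_form_in_algebra)
qed

end
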